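(* An alternating sign matrix (ASM) has an orthogonal mate if and only if it is not one of the three matrices $$I_2=\begin{pmatrix}1&0\\0&1\end{pmatrix},\qquad I_2'=\begin{pmatrix}0&1\\1&0\end{pmatrix},\qquad D_3=\begin{pmatrix}0&1&0\\1&-1&1\\0&1&0\end{pmatrix}.$$ Moreover, every ASM with an orthogonal mate is orthogonal to a permutation matrix; that is, if an ASM $A$ of order $n$ has an orthogonal mate, then there is an $n\times n$ permutation matrix $P$ with $\langle A,P\rangle=1$.
   Context: An alternating sign matrix (ASM) is a matrix with entries in $\{0,1,-1\}$ such that in each row and each column the non-zero entries alternate in sign, beginning and ending with $+1$ (so every row and column sums to $1$, and the matrix is square). For $n\times n$ matrices, $\langle A,B\rangle=\operatorname{tr}(AB^\top)=\sum_{i,j}A_{ij}B_{ij}$ is the Frobenius inner product. Two ASMs $A$ and $B$ of the same order are orthogonal, and each is called an orthogonal mate of the other, if $\langle A,B\rangle=1$ ($A=B$ is allowed). Permutation matrices are ASMs. *)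

theory Defs
  imports "Jordan_Normal_Form.Matrix" "HOL-Combinatorics.Permutations"
begin

text \<open>Beginning and ending with \<open>1\<close> forces a non-zero entry to exist.\<close>

definition alternating_line :: "int vec \<Rightarrow> bool" where
  "alternating_line v \<longleftrightarrow>
     (let xs = filter (\<lambda>x. x \<noteq> 0) (list_of_vec v)
      in xs \<noteq> [] \<and> hd xs = 1 \<and> last xs = 1 \<and> successively (\<lambda>x y. y = - x) xs)"

text \<open>Squareness is not part of the definition; it is derived in \<open>is_asm_square\<close> below.
  The first conjunct excludes only the empty matrix, which would
  otherwise be an alternating sign matrix with no orthogonal mate.\<close>

definition is_asm :: "int mat \<Rightarrow> bool" where
  "is_asm A \<longleftrightarrow>
     0 < dim_row A \<and>
     elements_mat A \<subseteq> {0, 1, -1} \<and>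
     (\<forall>i < dim_row A. alternating_line (row A i)) \<and>
     (\<forall>j < dim_col A. alternating_line (col A j))"

text \<open>Meaningful only for matrices of the same dimensions.\<close>

definition frobenius_inner :: "int mat \<Rightarrow> int mat \<Rightarrow> int" where
  "frobenius_inner A B = (\<Sum>i<dim_row A. \<Sum>j<dim_col A. A $$ (i, j) * B $$ (i, j))"

lemma frobenius_inner_trace:
  assumes "A \<in> carrier_mat n m" "B \<in> carrier_mat n m"
  shows "frobenius_inner A B = (\<Sum>i<n. (A * B\<^sup>T) $$ (i, i))"
  using assms
  by (auto simp: frobenius_inner_def scalar_prod_def lessThan_atLeast0 intro!: sum.cong)

definition orthogonal_mate :: "int mat \<Rightarrow> int mat \<Rightarrow> bool" where
  "orthogonal_mate A B \<longleftrightarrow>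
     is_asm A \<and> is_asm B \<and> dim_row A = dim_row B \<and> dim_col A = dim_col B \<and>
     frobenius_inner A B = 1"

definition has_orthogonal_mate :: "int mat \<Rightarrow> bool" where
  "has_orthogonal_mate A \<longleftrightarrow> (\<exists>B. orthogonal_mate A B)"

definition permutation_matrix :: "nat \<Rightarrow> int mat \<Rightarrow> bool" where
  "permutation_matrix n P \<longleftrightarrow>
     (\<exists>p. p permutes {..<n} \<and> P = mat n n (\<lambda>(i, j). if j = p i then 1 else 0))"

definition I2 :: "int mat" where
  "I2 = mat_of_rows_list 2 [[1, 0],
                            [0, 1]]"

definition I2' :: "int mat" where
  "I2' = mat_of_rows_list 2 [[0, 1],
                             [1, 0]]"

definition D3 :: "int mat" where
  "D3 = mat_of_rows_list 3 [[0,  1, 0],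
                            [1, -1, 1],
                            [0,  1, 0]]"

lemma sum_list_alternating:
  fixes xs :: "int list"
  assumes "xs \<noteq> []" "successively (\<lambda>x y. y = - x) xs"
  shows "2 * sum_list xs = hd xs + last xs"
  using assms by (induction xs rule: induct_list012) auto

lemma sum_list_filter_nonzero:
  fixes xs :: "int list"
  shows "sum_list (filter (\<lambda>x. x \<noteq> 0) xs) = sum_list xs"
  by (induction xs) auto

lemma alternating_line_sum:
  assumes "alternating_line v"
  shows "(\<Sum>i<dim_vec v. v $ i) = 1"
proof -
  let ?xs = "filter (\<lambda>x. x \<noteq> 0) (list_of_vec v)"
  have "2 * sum_list ?xs = 2"
    using assms sum_list_alternating[of ?xs] by (simp add: alternating_line_def Let_def)
  moreover have "sum_list ?xs = sum_list (list_of_vec v)"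
    by (rule sum_list_filter_nonzero)
  moreover have "sum_list (list_of_vec v) = (\<Sum>i<dim_vec v. v $ i)"
    by (simp add: sum_list_sum_nth list_of_vec_index lessThan_atLeast0)
  ultimately show ?thesis by simp
qed

lemma is_asm_square:
  assumes "is_asm A"
  shows "square_mat A"
proof -
  have r: "(\<Sum>j<dim_col A. A $$ (i, j)) = 1" if "i < dim_row A" for i
    using assms alternating_line_sum[of "row A i"] that by (simp add: is_asm_def)
  have c: "(\<Sum>i<dim_row A. A $$ (i, j)) = 1" if "j < dim_col A" for j
    using assms alternating_line_sum[of "col A j"] that by (simp add: is_asm_def)
  have "int (dim_row A) = (\<Sum>i<dim_row A. \<Sum>j<dim_col A. A $$ (i, j))" by (simp add: r)
  also have "\<dots> = (\<Sum>j<dim_col A. \<Sum>i<dim_row A. A $$ (i, j))" by (rule sum.swap)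
  also have "\<dots> = int (dim_col A)" by (simp add: c)
  finally show ?thesis by simp
qed

end

theory Submission
  imports Defs "HOL-Number_Theory.Cong"
begin

text \<open>
The three exceptions fail for arithmetical reasons: for any matrix \<open>B\<close> with unit line sums, the
inner product with \<open>I2\<close> or \<open>I2'\<close> is even and the one with \<open>D3\<close> is \<open>2\<close> modulo \<open>3\<close>
(\<open>exceptional_has_no_mate\<close>). For every other alternating sign matrix \<open>A\<close> a permutation \<open>p\<close> with
\<open>\<Sum>k. A(k, p k) = 1\<close> has to be found; permutation matrices are alternating sign matrices, so this
proves both claims.

The average of \<open>\<Sum>k. A(k, p k)\<close> over all \<open>p\<close> is \<open>1\<close>, which suggests an intermediate value argument.
A transposition can change the sum by up to \<open>4\<close>, but the first and last rows of \<open>A\<close> are unit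
vectors. A row that is zero on all columns under consideration works as a hole: moving the hole
replaces one entry of one row by another entry of that row, so the sum changes by at most \<open>2\<close>, and
these moves connect all bijections. Hence a target near the average is either reached or jumped
over from one below to one above (\<open>bijection_sum_hits_or_jumps\<close>). The column of the \<open>1\<close> of the hole
row has to be taken by a prescribed row; \<open>completion_sum\<close> computes the average under such
prescriptions from line sums.

Let the first row have its \<open>1\<close> in column \<open>c\<close> and the last row in column \<open>d\<close>. If \<open>c \<noteq> d\<close>, these two rows can
raise the total by one at the end, so both \<open>0\<close> and \<open>1\<close> are good targets and cannot both be jumped over
(\<open>unit_transversal_of_distinct_unit_rows\<close>). The case of different outer columns is symmetric.
Otherwise the outer lines form a cross: the outer rows have their \<open>1\<close> in column \<open>c\<close> and the outer
columns in row \<open>r\<close>. Here a jump from \<open>0\<close> to \<open>2\<close> is repaired by moving the offending row into an outer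
column, where it is zero, and the row stored there into the column that becomes free
(\<open>unit_transversal_of_equal_unit_rows\<close>). It remains to choose prescriptions that make the average
close to \<open>1\<close>, depending on the entry \<open>A(r, c)\<close>; this fails only for \<open>D3\<close>
(\<open>unit_transversal_or_diamond_of_cross\<close>).
\<close>

section \<open>Partial sums of alternating lines\<close>

text \<open>Consecutive entries cancel in pairs, so only the head of a list of odd length survives.
Applied to prefixes this turns the alternation condition into the statement that
all partial sums are \<open>0\<close> or \<open>1\<close>, which is the only form in which it is used afterwards.\<close>

lemma alternating_list_sum:
  fixes xs :: "int list"
  assumes "successively (\<lambda>x y. y = - x) xs" "xs \<noteq> []"
  shows "sum_list xs \<in> {0, hd xs}"
  using assms by (induction xs rule: induct_list012) auto

lemma alternating_line_prefix_sum:
  assumes "alternating_line v" "k \<le> dim_vec v"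
  shows "(\<Sum>i<k. v $ i) \<in> {0, 1}"
proof -
  let ?nz = "filter (\<lambda>x::int. x \<noteq> 0)"
  let ?xs = "list_of_vec v"
  let ?ys = "?nz (take k ?xs)"
  have split: "?nz ?xs = ?ys @ ?nz (drop k ?xs)"
    by (metis append_take_drop_id filter_append)
  have "successively (\<lambda>x y. y = - x) (?nz ?xs)" and hd: "hd (?nz ?xs) = 1"
    using assms(1) by (simp_all add: alternating_line_def Let_def)
  then have "successively (\<lambda>x y. y = - x) ?ys"
    unfolding split successively_append_iff by blast
  moreover have "hd ?ys = 1" if "?ys \<noteq> []"
    using that hd unfolding split by simp
  ultimately have "sum_list ?ys \<in> {0, 1}"
    using alternating_list_sum[of ?ys] by (cases "?ys = []") auto
  moreover have "sum_list (take k ?xs) = (\<Sum>i<k. v $ i)"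
    using assms(2)
    by (simp add: sum_list_sum_nth list_of_vec_index lessThan_atLeast0 min_def)
  then have "sum_list ?ys = (\<Sum>i<k. v $ i)" by (simp only: sum_list_filter_nonzero)
  ultimately show ?thesis by simp
qed

section \<open>Permutation sums near the average\<close>

lemma bij_betw_shift_mod:
  fixes m s :: nat
  shows "bij_betw (\<lambda>x. (x + s) mod m) {..<m} {..<m}"
proof -
  have "inj_on (\<lambda>x. (x + s) mod m) {..<m}"
  proof (rule inj_onI)
    fix x y assume xy: "x \<in> {..<m}" "y \<in> {..<m}" and "(x + s) mod m = (y + s) mod m"
    then have "[x + s = y + s] (mod m)" by (simp add: cong_def)
    then have "[x = y] (mod m)" by (simp add: cong_add_rcancel_nat)
    with xy show "x = y" by (simp add: cong_def)
  qed
  moreover have "(\<lambda>x. (x + s) mod m) ` {..<m} \<subseteq> {..<m}" by auto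
  ultimately show ?thesis by (simp add: bij_betw_def endo_inj_surj)
qed

text \<open>Enumerate \<open>R\<close> and \<open>C\<close> by \<open>{..<m}\<close>. The \<open>m\<close> cyclic shifts are bijections that together use every
pair in \<open>R \<times> C\<close> exactly once, so already among these few bijections some sum is at least the
average over all of them.\<close>

lemma exists_bijection_sum_ge_average:
  fixes w :: "'a \<Rightarrow> 'b \<Rightarrow> int"
  assumes fin: "finite R" "finite C" and card: "card R = card C" and "R \<noteq> {}"
  shows "\<exists>q. bij_betw q R C \<and> (\<Sum>k\<in>R. \<Sum>l\<in>C. w k l) \<le> int (card R) * (\<Sum>k\<in>R. w k (q k))"
proof (rule ccontr)
  assume none: "\<not> ?thesis"
  define m where "m = card R"
  have m: "m > 0" using fin \<open>R \<noteq> {}\<close> by (simp add: m_def card_gt_0_iff)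
  obtain d where d: "bij_betw d R {..<m}"
    using ex_bij_betw_finite_nat[OF fin(1)] by (auto simp: m_def lessThan_atLeast0)
  obtain e where e: "bij_betw e {..<m} C"
    using ex_bij_betw_nat_finite[OF fin(2)] card by (auto simp: m_def lessThan_atLeast0)
  define q where "q s k = e ((d k + s) mod m)" for s k
  have "bij_betw (q s) R C" for s
    using bij_betw_trans[OF bij_betw_trans[OF d bij_betw_shift_mod[of s m]] e]
    by (simp add: q_def[abs_def] comp_def)
  with none have "int m * (\<Sum>k\<in>R. w k (q s k)) < (\<Sum>k\<in>R. \<Sum>l\<in>C. w k l)" for s
    by (auto simp: m_def not_le)
  then have "(\<Sum>s<m. int m * (\<Sum>k\<in>R. w k (q s k))) < (\<Sum>s<m. \<Sum>k\<in>R. \<Sum>l\<in>C. w k l)"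
    using m by (intro sum_strict_mono) auto
  then have "int m * (\<Sum>s<m. \<Sum>k\<in>R. w k (q s k)) < int m * (\<Sum>k\<in>R. \<Sum>l\<in>C. w k l)"
    by (simp add: sum_distrib_left)
  moreover have "(\<Sum>s<m. \<Sum>k\<in>R. w k (q s k)) = (\<Sum>k\<in>R. \<Sum>l\<in>C. w k l)"
  proof -
    have "(\<Sum>s<m. w k (q s k)) = (\<Sum>l\<in>C. w k l)" for k
    proof -
      have "bij_betw (\<lambda>s. q s k) {..<m} C"
        using bij_betw_trans[OF bij_betw_shift_mod[of "d k" m] e]
        by (simp add: q_def[abs_def] comp_def add.commute)
      then show ?thesis by (rule sum.reindex_bij_betw)
    qed
    then show ?thesis by (subst sum.swap) simp
  qed
  ultimately show False by simp
qed

lemma exists_bijection_sum_le_average: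
  fixes w :: "'a \<Rightarrow> 'b \<Rightarrow> int"
  assumes "finite R" "finite C" "card R = card C" "R \<noteq> {}"
  shows "\<exists>q. bij_betw q R C \<and> int (card R) * (\<Sum>k\<in>R. w k (q k)) \<le> (\<Sum>k\<in>R. \<Sum>l\<in>C. w k l)"
  using exists_bijection_sum_ge_average[OF assms, of "\<lambda>k l. - w k l"] by (simp add: sum_negf)

lemma sum_comp_transpose:
  fixes w :: "'a \<Rightarrow> 'b \<Rightarrow> int"
  assumes "finite R" "h \<in> R" "j \<in> R" "j \<noteq> h"
  shows "(\<Sum>k\<in>R. w k ((q \<circ> transpose h j) k)) =
    (\<Sum>k\<in>R. w k (q k)) + (w h (q j) - w h (q h)) + (w j (q h) - w j (q j))"
proof -
  have *: "(\<Sum>k\<in>R. g k) = g h + g j + (\<Sum>k\<in>R - {h, j}. g k)" for g :: "'a \<Rightarrow> int"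
  proof -
    have "R = insert h (insert j (R - {h, j}))" using assms by auto
    then have "sum g R = sum g (insert h (insert j (R - {h, j})))" by metis
    also have "\<dots> = g h + g j + (\<Sum>k\<in>R - {h, j}. g k)" using assms by simp
    finally show ?thesis .
  qed
  have "(\<Sum>k\<in>R - {h, j}. w k ((q \<circ> transpose h j) k)) = (\<Sum>k\<in>R - {h, j}. w k (q k))"
    by (rule sum.cong) auto
  then show ?thesis
    using *[of "\<lambda>k. w k ((q \<circ> transpose h j) k)"] *[of "\<lambda>k. w k (q k)"] by simp
qed

text \<open>The transpositions that move a fixed element \<open>h\<close> generate the symmetric group, because
\<open>(x y) = (h x)(h y)(h x)\<close>. When row \<open>h\<close> carries only zeros, the position of \<open>h\<close> acts as a hole,
and such a transposition moves one single entry of the sum.\<close>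

lemma star_transpositions_reach_all:
  assumes fin: "finite R" and h: "h \<in> R"
    and step: "\<And>q j. \<lbrakk>bij_betw q R C; P q; j \<in> R; j \<noteq> h\<rbrakk> \<Longrightarrow> P (q \<circ> transpose h j)"
    and q: "bij_betw q R C" "P q" and s: "s permutes R"
  shows "P (q \<circ> s)"
proof -
  have bij: "bij_betw (q \<circ> transpose x y) R C" if "bij_betw q R C" "x \<in> R" "y \<in> R" for q x y
    using that permutes_swap_id[of x R y] by (meson bij_betw_trans permutes_imp_bij)
  have star: "P (q \<circ> transpose h j)" if "bij_betw q R C" "P q" "j \<in> R" for q j
    using that step by (cases "j = h") auto
  have any: "P (q \<circ> transpose x y)" if "bij_betw q R C" "P q" "x \<in> R" "y \<in> R" for q x y
  proof -
    consider "x = y" | "x = h" | "y = h" | "x \<noteq> y" "x \<noteq> h" "y \<noteq> h" by blast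
    then show ?thesis
    proof cases
      case 4
      then have "q \<circ> transpose x y = q \<circ> transpose h x \<circ> transpose h y \<circ> transpose h x"
        by (auto simp: fun_eq_iff transpose_def)
      then show ?thesis using that h by (simp add: star bij)
    qed (use that star[of q x] star[of q y] in \<open>auto simp: transpose_commute\<close>)
  qed
  from fin s show ?thesis
  proof (induction rule: permutes_rev_induct)
    case id
    then show ?case using q by simp
  next
    case (swap x y p)
    then have "bij_betw (q \<circ> p) R C"
      using q(1) by (meson bij_betw_trans permutes_imp_bij)
    with swap show ?case using any[of "q \<circ> p" x y] by (simp only: comp_assoc)
  qed
qed

text \<open>A discrete intermediate value argument. Some bijection has sum at least \<open>t\<close> and some has sum at
most \<open>t\<close>, because the average lies strictly between \<open>t - 1\<close> and \<open>t + 1\<close>. They are connected by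
steps that replace one entry by another entry of the same row, which change the sum by at most
\<open>2\<close>. So \<open>t\<close> can be skipped only by a step from \<open>t - 1\<close> to \<open>t + 1\<close>, which replaces a \<open>-1\<close> by a
\<open>1\<close>.\<close>

lemma bijection_sum_hits_or_jumps:
  fixes w :: "'a \<Rightarrow> 'b \<Rightarrow> int" and t :: int
  assumes fin: "finite R" "finite C" and card: "card R = card C" and h: "h \<in> R"
    and zero: "\<And>l. l \<in> C \<Longrightarrow> w h l = 0"
    and entries: "\<And>k l. k \<in> R \<Longrightarrow> l \<in> C \<Longrightarrow> w k l \<in> {-1, 0, 1}"
    and lower: "(t - 1) * int (card R) < (\<Sum>k\<in>R. \<Sum>l\<in>C. w k l)"
    and upper: "(\<Sum>k\<in>R. \<Sum>l\<in>C. w k l) < (t + 1) * int (card R)"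
  shows "\<exists>q. bij_betw q R C \<and>
    ((\<Sum>k\<in>R. w k (q k)) = t \<or>
     (\<Sum>k\<in>R. w k (q k)) = t - 1 \<and> (\<exists>j\<in>R. j \<noteq> h \<and> w j (q j) = -1 \<and> w j (q h) = 1))"
proof (rule ccontr)
  define S where "S q = (\<Sum>k\<in>R. w k (q k))" for q
  assume "\<not> ?thesis"
  then have miss: "S q \<noteq> t"
    and no_jump: "\<lbrakk>S q = t - 1; j \<in> R; j \<noteq> h; w j (q j) = -1\<rbrakk> \<Longrightarrow> w j (q h) \<noteq> 1"
    if "bij_betw q R C" for q j
    using that unfolding S_def by blast+
  have m: "int (card R) > 0" "R \<noteq> {}" using fin h by (auto simp: card_gt_0_iff)
  obtain q1 where q1: "bij_betw q1 R C" "(\<Sum>k\<in>R. \<Sum>l\<in>C. w k l) \<le> int (card R) * S q1"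
    using exists_bijection_sum_ge_average[OF fin card m(2), of w] by (auto simp: S_def)
  obtain q2 where q2: "bij_betw q2 R C" "int (card R) * S q2 \<le> (\<Sum>k\<in>R. \<Sum>l\<in>C. w k l)"
    using exists_bijection_sum_le_average[OF fin card m(2), of w] by (auto simp: S_def)
  have "(t - 1) * int (card R) < S q1 * int (card R)"
    using q1(2) lower by (simp add: mult.commute)
  then have high: "S q1 \<ge> t" using m(1) by (simp only: mult_less_cancel_right) linarith
  have "S q2 * int (card R) < (t + 1) * int (card R)"
    using q2(2) upper by (simp add: mult.commute)
  then have "S q2 \<le> t" using m(1) by (simp only: mult_less_cancel_right) linarith
  with miss[OF q2(1)] have low: "S q2 < t" by linarith
  have step: "S (q \<circ> transpose h j) < t"
    if q: "bij_betw q R C" and "S q < t" and j: "j \<in> R" "j \<noteq> h" for q j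
  proof -
    have in_C: "q h \<in> C" "q j \<in> C" using q h j by (auto simp: bij_betw_def)
    \<comment> \<open>Row \<open>h\<close> is zero on \<open>C\<close>, so only the entry of row \<open>j\<close> changes.\<close>
    have change: "S (q \<circ> transpose h j) = S q + (w j (q h) - w j (q j))"
      unfolding S_def using sum_comp_transpose[OF fin(1) h j, of w q] in_C by (simp add: zero)
    have "bij_betw (q \<circ> transpose h j) R C"
      using q h j permutes_swap_id[of h R j] by (meson bij_betw_trans permutes_imp_bij)
    from miss[OF this] show ?thesis
      using change no_jump[OF q _ j] \<open>S q < t\<close> entries[OF j(1) in_C(1)] entries[OF j(1) in_C(2)]
      by (cases "S q = t - 1") auto
  qed
  define s where "s k = (if k \<in> R then inv_into R q2 (q1 k) else k)" for k
  have "bij_betw (inv_into R q2 \<circ> q1) R R"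
    using bij_betw_trans[OF q1(1) bij_betw_inv_into[OF q2(1)]] .
  then have "bij_betw s R R"
    by (rule bij_betw_cong[THEN iffD1, rotated]) (simp add: s_def)
  then have "s permutes R" by (rule bij_imp_permutes) (simp add: s_def)
  from star_transpositions_reach_all[where P = "\<lambda>q. S q < t", OF fin(1) h step q2(1) low this]
  have "S (q2 \<circ> s) < t" .
  moreover have "q2 (s k) = q1 k" if "k \<in> R" for k
    using that q1(1) q2(1) by (auto simp: s_def bij_betw_def intro!: f_inv_into_f)
  then have "S (q2 \<circ> s) = S q1" by (simp add: S_def)
  ultimately show False using high by linarith
qed

section \<open>Transversals of a square array with alternating lines\<close>

text \<open>Partial sums make the conditions symmetric under transposition and free of lists. The first and
last rows and columns are then unit vectors, since their entries are themselves partial sums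
from one end.\<close>

locale asm_array =
  fixes n :: nat and a :: "nat \<Rightarrow> nat \<Rightarrow> int"
  assumes row_prefix: "\<And>i k. i < n \<Longrightarrow> k \<le> n \<Longrightarrow> (\<Sum>j<k. a i j) \<in> {0, 1}"
    and col_prefix: "\<And>j k. j < n \<Longrightarrow> k \<le> n \<Longrightarrow> (\<Sum>i<k. a i j) \<in> {0, 1}"
    and row_sum: "\<And>i. i < n \<Longrightarrow> (\<Sum>j<n. a i j) = 1"
    and col_sum: "\<And>j. j < n \<Longrightarrow> (\<Sum>i<n. a i j) = 1"
begin

text \<open>The values of \<open>p\<close> outside \<open>{..<n}\<close> are left open, so that \<open>p\<close> can be glued from pieces and
inverted by \<open>inv_into\<close>.\<close>

definition unit_transversal :: bool where
  "unit_transversal \<longleftrightarrow> (\<exists>p. bij_betw p {..<n} {..<n} \<and> (\<Sum>k<n. a k (p k)) = 1)"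

lemma transpose_asm_array: "asm_array n (\<lambda>i j. a j i)"
  by unfold_locales (simp_all add: row_prefix col_prefix row_sum col_sum del: insert_iff)

lemma entry: "i < n \<Longrightarrow> j < n \<Longrightarrow> a i j \<in> {-1, 0, 1}"
  using row_prefix[of i j] row_prefix[of i "Suc j"] by auto

lemma first_row_entry: "j < n \<Longrightarrow> a 0 j \<in> {0, 1}"
  using col_prefix[of j 1] by simp

lemma last_row_entry: "j < n \<Longrightarrow> a (n - 1) j \<in> {0, 1}"
  using col_prefix[of j "n - 1"] col_sum[of j] by (cases n) auto

lemma zero_one_row_unit:
  assumes "i < n" and "\<And>j. j < n \<Longrightarrow> a i j \<in> {0, 1}"
  obtains c where "c < n" "\<And>j. j < n \<Longrightarrow> a i j = (if j = c then 1 else 0)"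
proof -
  have "\<exists>c<n. a i c \<noteq> 0"
  proof (rule ccontr)
    assume "\<not> ?thesis"
    then have "(\<Sum>j<n. a i j) = 0" by (intro sum.neutral) auto
    then show False using row_sum[OF assms(1)] by simp
  qed
  then obtain c where c: "c < n" "a i c \<noteq> 0" by blast
  then have one: "a i c = 1" using assms(2)[of c] by auto
  have "(\<Sum>j\<in>{..<n} - {c}. a i j) = 0"
    using row_sum[OF assms(1)] c(1) one by (simp add: sum_diff1)
  then have "\<forall>j\<in>{..<n} - {c}. a i j = 0"
    using assms(2) by (subst (asm) sum_nonneg_eq_0_iff) fastforce+
  with one c(1) show ?thesis by (intro that[of c]) auto
qed

lemma first_row_unit:
  assumes "0 < n"
  obtains c where "c < n" "\<And>j. j < n \<Longrightarrow> a 0 j = (if j = c then 1 else 0)"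
  by (rule zero_one_row_unit[of 0]) (use assms first_row_entry that in auto)

lemma last_row_unit:
  assumes "0 < n"
  obtains c where "c < n" "\<And>j. j < n \<Longrightarrow> a (n - 1) j = (if j = c then 1 else 0)"
  by (rule zero_one_row_unit[of "n - 1"]) (use assms last_row_entry that in auto)

text \<open>Prescribe \<open>p\<close> on a set \<open>F\<close> of rows by \<open>f\<close> and complete it on the \<open>m\<close> other rows. Since all lines
sum to \<open>1\<close>, inclusion and exclusion gives \<open>m - card F + G\<close> for the sum of the entries in the
free rows and columns, where \<open>G\<close> is the sum over \<open>F \<times> f ` F\<close>. So whether the average of the
completed sums is near \<open>t\<close> depends, besides \<open>n\<close>, only on the few entries in that small block.\<close>

lemma completion_sum:
  fixes f :: "nat \<Rightarrow> nat" and t :: int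
  assumes F: "F \<subseteq> {..<n}" "inj_on f F" "f ` F \<subseteq> {..<n}"
    and h: "h < n" "h \<notin> F"
    and zero: "\<And>l. l < n \<Longrightarrow> l \<notin> f ` F \<Longrightarrow> a h l = 0"
    and m: "m = int n - int (card F)"
    and B: "B = (\<Sum>k\<in>F. a k (f k))"
    and G: "G = (\<Sum>k\<in>F. \<Sum>l\<in>f ` F. a k l)"
    and lower: "(t - 1) * m < B * m + m - int (card F) + G"
    and upper: "B * m + m - int (card F) + G < (t + 1) * m"
  shows "\<exists>p. bij_betw p {..<n} {..<n} \<and> (\<forall>k\<in>F. p k = f k) \<and>
    ((\<Sum>k<n. a k (p k)) = t \<or>
     (\<Sum>k<n. a k (p k)) = t - 1 \<and>
       (\<exists>j<n. j \<notin> F \<and> j \<noteq> h \<and> a j (p j) = -1 \<and> a j (p h) = 1))"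
proof -
  define R where "R = {..<n} - F"
  define D where "D = f ` F"
  define C where "C = {..<n} - D"
  have finF: "finite F" using F(1) finite_subset by blast
  have cardD: "card D = card F" using F(2) by (simp add: D_def card_image)
  have fin: "finite R" "finite C" "finite D" using finF by (auto simp: R_def C_def D_def)
  have cF: "card F \<le> n" using card_mono[OF _ F(1)] by simp
  have cR: "int (card R) = m" using F(1) finF cF by (simp add: R_def card_Diff_subset m of_nat_diff)
  have cC: "card C = card R"
    using F(1,3) finF fin(3) cardD by (simp add: R_def C_def card_Diff_subset D_def)
  have "(\<Sum>k\<in>R. \<Sum>l\<in>C. a k l) = (\<Sum>k\<in>R. 1 - (\<Sum>l\<in>D. a k l))"
  proof (rule sum.cong)
    fix k assume "k \<in> R"
    then show "(\<Sum>l\<in>C. a k l) = 1 - (\<Sum>l\<in>D. a k l)"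
      using F(3) row_sum[of k] by (simp add: C_def R_def D_def sum_diff)
  qed simp
  also have "\<dots> = m - (\<Sum>l\<in>D. \<Sum>k\<in>R. a k l)"
    using sum.swap[of a D R] by (simp add: sum_subtractf cR)
  also have "(\<Sum>l\<in>D. \<Sum>k\<in>R. a k l) = (\<Sum>l\<in>D. 1 - (\<Sum>k\<in>F. a k l))"
  proof (rule sum.cong)
    fix l assume "l \<in> D"
    then show "(\<Sum>k\<in>R. a k l) = 1 - (\<Sum>k\<in>F. a k l)"
      using F col_sum[of l] by (auto simp add: R_def D_def sum_diff)
  qed simp
  also have "\<dots> = int (card F) - G"
    using sum.swap[of a D F] by (simp add: sum_subtractf G cardD D_def[symmetric])
  finally have W: "(\<Sum>k\<in>R. \<Sum>l\<in>C. a k l) = m - int (card F) + G" by simp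
  have "\<exists>q. bij_betw q R C \<and>
    ((\<Sum>k\<in>R. a k (q k)) = t - B \<or> (\<Sum>k\<in>R. a k (q k)) = t - B - 1 \<and>
      (\<exists>j\<in>R. j \<noteq> h \<and> a j (q j) = -1 \<and> a j (q h) = 1))"
  proof (rule bijection_sum_hits_or_jumps)
    show "card R = card C" "h \<in> R" using cC h by (simp_all add: R_def)
    show "a h l = 0" if "l \<in> C" for l using that zero by (simp add: C_def D_def)
    show "a k l \<in> {-1, 0, 1}" if "k \<in> R" "l \<in> C" for k l
      using that entry by (simp add: R_def C_def)
    show "(t - B - 1) * int (card R) < (\<Sum>k\<in>R. \<Sum>l\<in>C. a k l)"
      using lower unfolding W cR by (simp add: algebra_simps)
    show "(\<Sum>k\<in>R. \<Sum>l\<in>C. a k l) < (t - B + 1) * int (card R)"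
      using upper unfolding W cR by (simp add: algebra_simps)
  qed (use fin in simp_all)
  then obtain q where q: "bij_betw q R C" and
    sum_q: "(\<Sum>k\<in>R. a k (q k)) = t - B \<or> (\<Sum>k\<in>R. a k (q k)) = t - B - 1 \<and>
      (\<exists>j\<in>R. j \<noteq> h \<and> a j (q j) = -1 \<and> a j (q h) = 1)"
    by blast
  define p where "p k = (if k \<in> F then f k else q k)" for k
  have pF: "bij_betw p F D"
    using F(2) by (auto simp: bij_betw_def D_def p_def inj_on_def)
  have "bij_betw p R C"
    using q by (subst bij_betw_cong[of R p q]) (auto simp: R_def p_def)
  from bij_betw_combine[OF pF this]
  have bij: "bij_betw p {..<n} {..<n}"
    using F(1,3) by (simp add: R_def C_def D_def Un_absorb1)
  have "(\<Sum>k<n. a k (p k)) = B + (\<Sum>k\<in>R. a k (q k))"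
  proof -
    have "(\<Sum>k<n. a k (p k)) = (\<Sum>k\<in>F. a k (p k)) + (\<Sum>k\<in>R. a k (p k))"
      using F(1) sum.subset_diff[of F "{..<n}" "\<lambda>k. a k (p k)"] by (simp add: R_def)
    then show ?thesis by (simp add: B p_def R_def)
  qed
  moreover have "\<exists>j<n. j \<notin> F \<and> j \<noteq> h \<and> a j (p j) = -1 \<and> a j (p h) = 1"
    if "\<exists>j\<in>R. j \<noteq> h \<and> a j (q j) = -1 \<and> a j (q h) = 1"
  proof -
    from that obtain j where "j < n" "j \<notin> F" "j \<noteq> h" "a j (q j) = -1" "a j (q h) = 1"
      by (auto simp: R_def)
    with h(2) show ?thesis by (intro exI[of _ j]) (simp add: p_def)
  qed
  ultimately have "(\<Sum>k<n. a k (p k)) = t \<or> (\<Sum>k<n. a k (p k)) = t - 1 \<and>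
       (\<exists>j<n. j \<notin> F \<and> j \<noteq> h \<and> a j (p j) = -1 \<and> a j (p h) = 1)"
    using sum_q by (elim disjE conjE) simp_all
  moreover have "p k = f k" if "k \<in> F" for k using that by (simp add: p_def)
  ultimately show ?thesis using bij by blast
qed

lemma unit_transversal_swap:
  assumes p: "bij_betw p {..<n} {..<n}" and x: "x < n" "y < n" "x \<noteq> y"
    and "(\<Sum>k<n. a k (p k)) + (a x (p y) - a x (p x)) + (a y (p x) - a y (p y)) = 1"
  shows unit_transversal
proof -
  have "bij_betw (p \<circ> transpose x y) {..<n} {..<n}"
    using permutes_swap_id[of x "{..<n}" y] p x by (meson bij_betw_trans lessThan_iff permutes_imp_bij)
  moreover have "(\<Sum>k<n. a k ((p \<circ> transpose x y) k)) = 1"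
    using assms(5) sum_comp_transpose[of "{..<n}" x y a p] x by simp
  ultimately show ?thesis unfolding unit_transversal_def by blast
qed

text \<open>Send \<open>i\<close> to \<open>d\<close> and \<open>l\<close> to \<open>c\<close>, so that row \<open>l\<close> contributes \<open>0\<close>, and use row \<open>h\<close> as the hole. A total
of \<open>0\<close> is as good as a total of \<open>1\<close>, because exchanging the columns of \<open>h\<close> and \<open>l\<close> puts row \<open>h\<close> on
its entry \<open>1\<close>. No step of size \<open>2\<close> jumps over both \<open>0\<close> and \<open>1\<close>.\<close>

lemma unit_transversal_of_distinct_unit_rows:
  assumes hl: "h < n" "l < n" "h \<noteq> l" and cd: "c < n" "d < n" "c \<noteq> d"
    and row_h: "\<And>j. j < n \<Longrightarrow> a h j = (if j = c then 1 else 0)"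
    and row_l: "\<And>j. j < n \<Longrightarrow> a l j = (if j = d then 1 else 0)"
    and i: "i < n" "i \<noteq> h" "i \<noteq> l"
    and good: "a i d = 0 \<or> a i d = 1 \<and> a i c = -1"
  shows unit_transversal
proof -
  define f where "f k = (if k = i then d else c)" for k
  define m where "m = int n - 2"
  have sub: "{h, i, l} \<subseteq> {..<n}" using hl i by auto
  have "card {h, i, l} = 3" using hl i by simp
  then have "3 \<le> n" using card_mono[OF _ sub] by simp
  then have m1: "m \<ge> 1" by (simp add: m_def)
  \<comment> \<open>For \<open>n = 3\<close> column \<open>c\<close> would consist of \<open>1\<close>, \<open>-1\<close>, \<open>0\<close> and not sum to \<open>1\<close>.\<close>
  have m2: "m \<ge> 2" if "a i c = -1"
  proof (rule ccontr)
    assume "\<not> m \<ge> 2"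
    with \<open>3 \<le> n\<close> have "n = 3" by (simp add: m_def)
    then have "card {..<n} = card {h, i, l}" using \<open>card {h, i, l} = 3\<close> by simp
    then have "{h, i, l} = {..<n}" using sub by (intro card_subset_eq) auto
    then have "(\<Sum>k\<in>{h, i, l}. a k c) = 1" using col_sum[OF cd(1)] by simp
    then show False using that hl i cd row_h row_l by simp
  qed
  have ic: "a i c \<in> {-1, 0, 1}" using entry i cd by simp
  \<comment> \<open>The average can be exactly \<open>0\<close>, and then the target has to be \<open>0\<close> and not \<open>1\<close>.\<close>
  define t :: int where "t = (if m - 1 + a i d * (m + 1) + a i c > 0 then 1 else 0)"
  have bounds: "(t - 1) * m < a i d * m + m - 2 + (a i d + a i c + 1)"
    "a i d * m + m - 2 + (a i d + a i c + 1) < (t + 1) * m"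
    using good ic m1 m2 by (auto simp: t_def)
  have "\<exists>p. bij_betw p {..<n} {..<n} \<and> (\<forall>k\<in>{i, l}. p k = f k) \<and>
    ((\<Sum>k<n. a k (p k)) = t \<or> (\<Sum>k<n. a k (p k)) = t - 1 \<and>
       (\<exists>j<n. j \<notin> {i, l} \<and> j \<noteq> h \<and> a j (p j) = -1 \<and> a j (p h) = 1))"
  proof (rule completion_sum[of "{i, l}" f h m "a i d" "a i d + a i c + 1" t])
    show "inj_on f {i, l}" using cd i by (auto simp: f_def inj_on_def)
    show "a h j = 0" if "j < n" "j \<notin> f ` {i, l}" for j
      using that i row_h by (auto simp: f_def)
    show "m = int n - int (card {i, l})" using i by (simp add: m_def)
    show "a i d = (\<Sum>k\<in>{i, l}. a k (f k))" using i cd row_l by (simp add: f_def)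
    show "a i d + a i c + 1 = (\<Sum>k\<in>{i, l}. \<Sum>j\<in>f ` {i, l}. a k j)"
      using i cd row_l by (simp add: f_def)
  qed (use hl i cd bounds in \<open>auto simp: f_def\<close>)
  then obtain p where p: "bij_betw p {..<n} {..<n}" "p i = f i" "p l = f l"
    and sum_p: "(\<Sum>k<n. a k (p k)) = t \<or> (\<Sum>k<n. a k (p k)) = t - 1 \<and>
       (\<exists>j<n. j \<notin> {i, l} \<and> j \<noteq> h \<and> a j (p j) = -1 \<and> a j (p h) = 1)"
    by auto
  have pi: "p i = d" "p l = c" using p(2,3) i by (simp_all add: f_def)
  have "p h < n" using bij_betw_apply[OF p(1)] hl(1) by simp
  moreover have "p h \<noteq> p l" "p h \<noteq> p i"
    using inj_on_eq_iff[OF bij_betw_imp_inj_on[OF p(1)]] hl i by simp_all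
  ultimately have ph: "p h < n" "p h \<noteq> c" "p h \<noteq> d" by (simp_all add: pi)
  consider "(\<Sum>k<n. a k (p k)) = 1" | "(\<Sum>k<n. a k (p k)) = 0"
    | j where "(\<Sum>k<n. a k (p k)) = -1" "j < n" "j \<noteq> h" "a j (p j) = -1" "a j (p h) = 1"
    using sum_p unfolding t_def by (auto split: if_splits)
  then show ?thesis
  proof cases
    case 1
    then show ?thesis using p(1) by (auto simp: unit_transversal_def)
  next
    case 2
    then show ?thesis
      using ph pi hl cd row_h row_l by (intro unit_transversal_swap[OF p(1), of h l]) auto
  next
    case 3
    have pj: "p j < n" using bij_betw_apply[OF p(1)] 3(2) by simp
    have "j \<noteq> l" using 3(4) row_l[OF pj] by (auto split: if_splits)
    then have "p j \<noteq> c"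
      using inj_on_eq_iff[OF bij_betw_imp_inj_on[OF p(1)], of j l] 3(2) hl(2) pi(2) by simp
    with 3 pj show ?thesis
      using ph hl row_h by (intro unit_transversal_swap[OF p(1), of h j]) auto
  qed
qed

text \<open>If the target \<open>1\<close> is skipped, then at total \<open>0\<close> some row \<open>j\<close> sits on an entry \<open>-1\<close>. Row \<open>l\<close> occupies
the column \<open>e\<close>, in which only row \<open>r\<close> has a non-zero entry, and \<open>r\<close> is prescribed. Exchanging the
columns of \<open>j\<close> and \<open>l\<close> therefore replaces the \<open>-1\<close> by a \<open>0\<close> and leaves the contribution of \<open>l\<close>
at \<open>0\<close>.\<close>

lemma unit_transversal_of_equal_unit_rows:
  assumes hl: "h < n" "l < n" "h \<noteq> l"
    and row_h: "\<And>j. j < n \<Longrightarrow> a h j = (if j = c then 1 else 0)"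
    and row_l: "\<And>j. j < n \<Longrightarrow> a l j = (if j = c then 1 else 0)"
    and col_e: "\<And>k. k < n \<Longrightarrow> a k e = (if k = r then 1 else 0)"
    and e: "e \<noteq> c"
    and F: "F \<subseteq> {..<n}" "inj_on f F" "f ` F \<subseteq> {..<n}"
      "h \<notin> F" "l \<in> F" "r \<in> F" "f l = e" "c \<in> f ` F"
    and m: "m = int n - int (card F)"
    and B: "B = (\<Sum>k\<in>F. a k (f k))"
    and G: "G = (\<Sum>k\<in>F. \<Sum>l\<in>f ` F. a k l)"
    and bound: "\<bar>B * m + G - int (card F)\<bar> < m"
  shows unit_transversal
proof -
  have "\<exists>p. bij_betw p {..<n} {..<n} \<and> (\<forall>k\<in>F. p k = f k) \<and>
    ((\<Sum>k<n. a k (p k)) = 1 \<or> (\<Sum>k<n. a k (p k)) = 1 - 1 \<and>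
       (\<exists>j<n. j \<notin> F \<and> j \<noteq> h \<and> a j (p j) = -1 \<and> a j (p h) = 1))"
  proof (rule completion_sum[OF F(1-3) hl(1) F(4) _ m B G, of 1])
    show "a h j = 0" if "j < n" "j \<notin> f ` F" for j
      using that F(8) row_h by auto
    show "(1 - 1) * m < B * m + m - int (card F) + G" "B * m + m - int (card F) + G < (1 + 1) * m"
      using bound by (simp_all add: abs_less_iff)
  qed
  then obtain p where p: "bij_betw p {..<n} {..<n}" "\<And>k. k \<in> F \<Longrightarrow> p k = f k"
    and sum_p: "(\<Sum>k<n. a k (p k)) = 1 \<or> (\<Sum>k<n. a k (p k)) = 0 \<and>
       (\<exists>j<n. j \<notin> F \<and> j \<noteq> h \<and> a j (p j) = -1 \<and> a j (p h) = 1)"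
    by auto
  show ?thesis
  proof (cases "(\<Sum>k<n. a k (p k)) = 1")
    case True
    then show ?thesis using p(1) by (auto simp: unit_transversal_def)
  next
    case False
    with sum_p obtain j where j: "j < n" "j \<notin> F" "a j (p j) = -1" and "(\<Sum>k<n. a k (p k)) = 0"
      by auto
    moreover have "p l = e" using p(2) F(5,7) by simp
    moreover have "e < n" using F(3,5,7) by auto
    then have "l \<noteq> r" using row_l[of e] col_e[of l] hl(2) e by auto
    moreover have "p j < n" using bij_betw_apply[OF p(1)] j(1) by simp
    moreover obtain x where "x \<in> F" "f x = c" using F(8) by auto
    then have "p x = c" "x \<noteq> j" "x < n" using p(2) j(2) F(1) by auto
    then have "p j \<noteq> c"
      using inj_on_eq_iff[OF bij_betw_imp_inj_on[OF p(1)], of j x] j(1) by simp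
    moreover have "j \<noteq> r" "j \<noteq> l" using j(2) F(5,6) by auto
    ultimately show ?thesis
      using hl row_l col_e by (intro unit_transversal_swap[OF p(1), of j l]) auto
  qed
qed

lemma unit_transversal_transpose:
  assumes "asm_array.unit_transversal n (\<lambda>i j. a j i)"
  shows unit_transversal
proof -
  interpret T: asm_array n "\<lambda>i j. a j i" by (rule transpose_asm_array)
  from assms obtain p where p: "bij_betw p {..<n} {..<n}" "(\<Sum>k<n. a (p k) k) = 1"
    unfolding T.unit_transversal_def by blast
  define q where "q = inv_into {..<n} p"
  have q: "bij_betw q {..<n} {..<n}" unfolding q_def by (rule bij_betw_inv_into[OF p(1)])
  have "(\<Sum>k<n. a k (q k)) = (\<Sum>k<n. a (p k) (q (p k)))"
    by (rule sum.reindex_bij_betw[OF p(1), symmetric])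
  also have "\<dots> = (\<Sum>k<n. a (p k) k)"
    using bij_betw_inv_into_left[OF p(1)] by (intro sum.cong) (simp_all add: q_def)
  finally show ?thesis using p(2) q unfolding unit_transversal_def by auto
qed

lemma top_two: "j < n \<Longrightarrow> 2 \<le> n \<Longrightarrow> a 0 j + a 1 j \<in> {0, 1}"
  using col_prefix[of j 2] by (simp add: numeral_2_eq_2)

lemma top_three: "j < n \<Longrightarrow> 3 \<le> n \<Longrightarrow> a 0 j + a 1 j + a 2 j \<in> {0, 1}"
  using col_prefix[of j 3] by (simp add: numeral_3_eq_3 numeral_2_eq_2)

lemma bottom_two:
  assumes "j < n" "2 \<le> n"
  shows "a (n - 2) j + a (n - 1) j \<in> {0, 1}"
proof -
  obtain k where "n = Suc (Suc k)" using assms(2) by (metis add_2_eq_Suc le_Suc_ex)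
  then show ?thesis using assms col_prefix[of j k] col_sum[of j] by auto
qed

lemma bottom_three:
  assumes "j < n" "3 \<le> n"
  shows "a (n - 3) j + a (n - 2) j + a (n - 1) j \<in> {0, 1}"
proof -
  obtain k where "n = Suc (Suc (Suc k))" using assms(2) by (metis add_Suc add_0 le_Suc_ex numeral_3_eq_3)
  then show ?thesis using assms col_prefix[of j k] col_sum[of j] by auto
qed

text \<open>A middle zero in column \<open>d\<close>, or by the up-down symmetry in column \<open>c\<close>, is a row to prescribe. If
there is none, the second row has to continue the alternation in both columns, with \<open>-1\<close> below
the \<open>1\<close> in column \<open>c\<close> and the first \<open>1\<close> of column \<open>d\<close>.\<close>

lemma unit_transversal_of_distinct_outer_rows:
  assumes n: "3 \<le> n" and cd: "c < n" "d < n" "c \<noteq> d"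
    and first: "\<And>j. j < n \<Longrightarrow> a 0 j = (if j = c then 1 else 0)"
    and last: "\<And>j. j < n \<Longrightarrow> a (n - 1) j = (if j = d then 1 else 0)"
  shows unit_transversal
proof -
  consider i where "0 < i" "i < n - 1" "a i d = 0" | i where "0 < i" "i < n - 1" "a i c = 0"
    | "a 1 d \<noteq> 0" "a 1 c \<noteq> 0"
    using n by force
  then show ?thesis
  proof cases
    case 1
    with n cd show ?thesis
      by (intro unit_transversal_of_distinct_unit_rows[OF _ _ _ cd first last, of i]) auto
  next
    case 2
    with n cd show ?thesis
      by (intro unit_transversal_of_distinct_unit_rows[OF _ _ _ cd(2,1) _ last first, of i]) auto
  next
    case 3
    then have "a 1 d = 1" "a 1 c = -1"
      using n cd top_two[of c] top_two[of d] first by auto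
    with n cd show ?thesis
      by (intro unit_transversal_of_distinct_unit_rows[OF _ _ _ cd first last, of 1]) auto
  qed
qed

text \<open>Prescribe the entry \<open>(i, c)\<close>, the \<open>1\<close> at \<open>(r, 0)\<close> and the \<open>0\<close> in the last corner. The bound says
that the average of the completions is within distance \<open>1\<close> of the total \<open>1\<close>; there are \<open>n - 3\<close>
free rows.\<close>

lemma unit_transversal_of_cross:
  assumes c: "0 < c" "c < n - 1" and r: "0 < r" "r < n - 1"
    and first_row: "\<And>j. j < n \<Longrightarrow> a 0 j = (if j = c then 1 else 0)"
    and last_row: "\<And>j. j < n \<Longrightarrow> a (n - 1) j = (if j = c then 1 else 0)"
    and first_col: "\<And>i. i < n \<Longrightarrow> a i 0 = (if i = r then 1 else 0)"
    and last_col: "\<And>i. i < n \<Longrightarrow> a i (n - 1) = (if i = r then 1 else 0)"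
    and i: "0 < i" "i < n - 1" "i \<noteq> r"
    and bound: "\<bar>(1 + a i c) * (int n - 3) + a i c + a r c\<bar> < int n - 3"
  shows unit_transversal
proof -
  define f where "f k = (if k = i then c else if k = r then 0 else n - 1)" for k
  have f: "f i = c" "f r = 0" "f (n - 1) = n - 1" using i r by (auto simp: f_def)
  have B: "1 + a i c = (\<Sum>k\<in>{i, r, n - 1}. a k (f k))"
    using i c r by (simp add: f first_col last_col del: One_nat_def)
  have G: "3 + a i c + a r c = (\<Sum>k\<in>{i, r, n - 1}. \<Sum>j\<in>f ` {i, r, n - 1}. a k j)"
    using i c r by (simp add: f first_col last_col last_row del: One_nat_def)
  show ?thesis
    by (rule unit_transversal_of_equal_unit_rows[where h = 0 and l = "n - 1" and c = c and r = r
          and e = "n - 1" and f = f and m = "int n - 3", OF _ _ _ first_row last_row last_col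
          _ _ _ _ _ _ _ _ _ _ B G])
      (use c r i bound in \<open>auto simp: f inj_on_def simp del: One_nat_def\<close>)
qed

text \<open>A zero centre can itself be prescribed, together with a zero corner. The average of the
completions is then exactly \<open>1\<close>.\<close>

lemma unit_transversal_of_cross_centre_zero:
  assumes c: "0 < c" "c < n - 1" and r: "0 < r" "r < n - 1"
    and first_row: "\<And>j. j < n \<Longrightarrow> a 0 j = (if j = c then 1 else 0)"
    and last_row: "\<And>j. j < n \<Longrightarrow> a (n - 1) j = (if j = c then 1 else 0)"
    and first_col: "\<And>i. i < n \<Longrightarrow> a i 0 = (if i = r then 1 else 0)"
    and centre: "a r c = 0"
  shows unit_transversal
proof -
  define f where "f k = (if k = r then c else 0)" for k
  have f: "f r = c" "f (n - 1) = 0" using r by (auto simp: f_def)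
  have B: "0 = (\<Sum>k\<in>{r, n - 1}. a k (f k))"
    using c r centre by (simp add: f first_col del: One_nat_def)
  have G: "2 = (\<Sum>k\<in>{r, n - 1}. \<Sum>j\<in>f ` {r, n - 1}. a k j)"
    using c r centre by (simp add: f first_col last_row del: One_nat_def)
  show ?thesis
    by (rule unit_transversal_of_equal_unit_rows[where h = 0 and l = "n - 1" and c = c and r = r
          and e = 0 and f = f and m = "int n - 2", OF _ _ _ first_row last_row first_col
          _ _ _ _ _ _ _ _ _ _ B G])
      (use c r in \<open>auto simp: f inj_on_def simp del: One_nat_def\<close>)
qed

lemma minus_one_above:
  assumes "r < n" "j < n" "0 < r" "a 0 j = 1" "a r j = 1"
  obtains i where "0 < i" "i < r" "a i j = -1"
proof -
  have "\<exists>i<r. a i j < 0"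
  proof (rule ccontr)
    assume "\<not> ?thesis"
    then have "\<forall>i<r. 0 \<le> a i j" by (meson not_less)
    then have "a 0 j \<le> (\<Sum>i<r. a i j)" using assms(3) by (intro member_le_sum) auto
    then show False using assms col_prefix[of j "Suc r"] by auto
  qed
  then obtain i where i: "i < r" "a i j < 0" by blast
  then have "a i j = -1" using entry[of i j] assms by auto
  moreover have "i \<noteq> 0" using i assms by (metis not_one_less_zero)
  ultimately show ?thesis using i by (intro that[of i]) auto
qed

text \<open>The sign at the centre of the cross decides what to prescribe: the zero centre itself; a \<open>-1\<close>
between two entries \<open>1\<close> if the centre is \<open>1\<close>; and, if the centre is \<open>-1\<close>, a zero on one of the two
arms. If both arms are free of zeros and \<open>n \<noteq> 3\<close>, their alternation keeps the centre far from the
border, so \<open>n \<ge> 7\<close> and there is enough room for the bound with \<open>i = 1\<close>.\<close>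

lemma unit_transversal_or_diamond_of_cross:
  assumes c: "0 < c" "c < n - 1" and r: "0 < r" "r < n - 1"
    and first_row: "\<And>j. j < n \<Longrightarrow> a 0 j = (if j = c then 1 else 0)"
    and last_row: "\<And>j. j < n \<Longrightarrow> a (n - 1) j = (if j = c then 1 else 0)"
    and first_col: "\<And>i. i < n \<Longrightarrow> a i 0 = (if i = r then 1 else 0)"
    and last_col: "\<And>i. i < n \<Longrightarrow> a i (n - 1) = (if i = r then 1 else 0)"
  shows "unit_transversal \<or> n = 3 \<and> a r c = -1"
proof -
  interpret T: asm_array n "\<lambda>i j. a j i" by (rule transpose_asm_array)
  note cross = unit_transversal_of_cross[OF c r first_row last_row first_col last_col]
  note cross_transposed = T.unit_transversal_of_cross[OF r c first_col last_col first_row last_row]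
  have lt: "r < n" "c < n" "0 < n" "n - 1 < n" using c r by auto
  have four: "4 \<le> n" if "0 < i" "i < n - 1" "0 < j" "j < n - 1" "i \<noteq> j" for i j :: nat
    using that by linarith
  consider "a r c = 0" | "a r c = 1" | "a r c = -1" using entry[OF lt(1,2)] by auto
  then show ?thesis
  proof cases
    case 1
    then show ?thesis
      using unit_transversal_of_cross_centre_zero[OF c r first_row last_row first_col] by blast
  next
    case 2
    obtain i where i: "0 < i" "i < r" "a i c = -1"
      using minus_one_above[OF lt(1,2) r(1) _ 2] first_row[OF lt(2)] by auto
    then have "4 \<le> n" using r by linarith
    with i r 2 show ?thesis using cross[of i] by simp
  next
    case 3
    consider "n = 3"
      | i where "0 < i" "i < n - 1" "i \<noteq> r" "a i c = 0"
      | j where "0 < j" "j < n - 1" "j \<noteq> c" "a r j = 0"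
      | "n \<noteq> 3" and "\<And>i. 0 < i \<Longrightarrow> i < n - 1 \<Longrightarrow> a i c \<noteq> 0"
        and "\<And>j. 0 < j \<Longrightarrow> j < n - 1 \<Longrightarrow> a r j \<noteq> 0"
      using 3 by (metis zero_neq_neg_one)
    then show ?thesis
    proof cases
      case 1
      with 3 show ?thesis by simp
    next
      case (2 i)
      with four[OF 2(1,2) r] have "4 \<le> n" by simp
      with 2 3 show ?thesis using cross[of i] by simp
    next
      case (3 j)
      with four[OF 3(1,2) c] have "4 \<le> n" by simp
      with 3 \<open>a r c = -1\<close> have "T.unit_transversal" using cross_transposed[of j] by simp
      then show ?thesis using unit_transversal_transpose by blast
    next
      case 4
      have n4: "4 \<le> n" using 4(1) c by linarith
      have "a r 1 = -1" "a r (n - 2) = -1"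
        using 4(3)[of 1] 4(3)[of "n - 2"] T.top_two[of r] T.bottom_two[of r] n4 lt
          first_col[of r] last_col[of r] by auto
      moreover have "1 \<noteq> n - 2" using n4 by linarith
      ultimately obtain z where z: "z < n" "z \<noteq> c" "a r z = -1" using n4
        by (metis diff_less lt(3) one_less_numeral_iff order.strict_trans2 semiring_norm(76) zero_less_numeral)
      \<comment> \<open>Column \<open>z\<close> has zeros at both ends, so it cannot have a \<open>-1\<close> next to either end.\<close>
      have "r \<noteq> 1" using z top_two[of z] n4 first_row[of z] by auto
      moreover have "r \<noteq> n - 2" using z bottom_two[of z] n4 last_row[of z] by auto
      moreover have c1: "a 1 c = -1" "a (n - 2) c = -1"
        using 4(2)[of 1] 4(2)[of "n - 2"] top_two[of c] bottom_two[of c] n4 lt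
          first_row[of c] last_row[of c] by auto
      moreover have "r \<noteq> 2" using 3 c1 top_three[of c] n4 lt first_row[of c] by auto
      moreover have "r \<noteq> n - 3" using 3 c1 bottom_three[of c] n4 lt last_row[of c] by auto
      ultimately have "3 \<le> r" "r + 4 \<le> n" using r by linarith+
      then show ?thesis using cross[of 1] c1(1) 3 by simp
    qed
  qed
qed

text \<open>Rows and columns are interchangeable here, so either the two outer rows or the two outer columns
differ, or the outer lines form a cross.\<close>

lemma unit_transversal_or_exceptional:
  assumes "0 < n"
  shows "unit_transversal \<or>
    n = 2 \<and> ((\<forall>i<2. \<forall>j<2. a i j = (if i = j then 1 else 0)) \<or>
             (\<forall>i<2. \<forall>j<2. a i j = (if i = j then 0 else 1))) \<or>
    n = 3 \<and> (\<forall>i<3. \<forall>j<3. a i j = (if i = 1 \<and> j = 1 then -1 else if i = 1 \<or> j = 1 then 1 else 0))"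
proof -
  interpret T: asm_array n "\<lambda>i j. a j i" by (rule transpose_asm_array)
  obtain c where c: "c < n" and first_row: "\<And>j. j < n \<Longrightarrow> a 0 j = (if j = c then 1 else 0)"
    by (rule first_row_unit[OF assms]) blast
  obtain d where d: "d < n" and last_row: "\<And>j. j < n \<Longrightarrow> a (n - 1) j = (if j = d then 1 else 0)"
    by (rule last_row_unit[OF assms]) blast
  obtain r where r: "r < n" and first_col: "\<And>i. i < n \<Longrightarrow> a i 0 = (if i = r then 1 else 0)"
    by (rule T.first_row_unit[OF assms]) blast
  obtain s where s: "s < n" and last_col: "\<And>i. i < n \<Longrightarrow> a i (n - 1) = (if i = s then 1 else 0)"
    by (rule T.last_row_unit[OF assms]) blast
  consider "n = 1" | "n = 2" | "3 \<le> n" using assms by linarith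
  then show ?thesis
  proof cases
    case 1
    then have "(\<Sum>k<n. a k (id k)) = 1" using row_sum[of 0] by simp
    then have unit_transversal unfolding unit_transversal_def by (intro exI[of _ id]) simp
    then show ?thesis ..
  next
    case 2
    have "a 0 0 + a 0 1 = 1" "a 0 0 + a 1 0 = 1" "a 1 0 + a 1 1 = 1" "a 0 0 \<in> {0, 1}"
      using 2 row_sum[of 0] row_sum[of 1] col_sum[of 0] first_row_entry[of 0]
      by (simp_all add: numeral_2_eq_2)
    with 2 show ?thesis by (auto simp: less_2_cases_iff)
  next
    case 3
    consider "c \<noteq> d" | "r \<noteq> s" | "c = d" "r = s" by blast
    then show ?thesis
    proof cases
      case 1
      then have unit_transversal
        using unit_transversal_of_distinct_outer_rows[OF 3 c d _ first_row last_row] by blast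
      then show ?thesis ..
    next
      case 2
      then have T.unit_transversal
        using T.unit_transversal_of_distinct_outer_rows[OF 3 r s _ first_col last_col] by blast
      then show ?thesis using unit_transversal_transpose by blast
    next
      case eq: 3
      note last_row' = last_row[folded eq(1)] and last_col' = last_col[folded eq(2)]
      \<comment> \<open>Each corner entry is read off once from a row and once from a column; this forces the \<open>1\<close>s off the corners.\<close>
      have corners: "(0 = c) = (0 = r)" "(n - 1 = c) = (0 = r)" "(0 = c) = (n - 1 = r)" "(n - 1 = c) = (n - 1 = r)"
        using first_row[of 0] first_row[of "n - 1"] last_row'[of 0] last_row'[of "n - 1"]
          first_col[of 0] first_col[of "n - 1"] last_col'[of 0] last_col'[of "n - 1"] 3
        by (auto split: if_splits)
      have inner: "0 < c" "c < n - 1" "0 < r" "r < n - 1" using corners 3 c r by linarith+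
      have "unit_transversal \<or> n = 3 \<and> a r c = -1"
        using unit_transversal_or_diamond_of_cross[OF inner first_row last_row' first_col last_col']
        by blast
      then show ?thesis
      proof (elim disjE conjE)
        assume "n = 3" "a r c = -1"
        moreover have "c = 1" "r = 1" using inner \<open>n = 3\<close> by auto
        ultimately show ?thesis
          using first_row last_row' first_col last_col'
          by (auto simp: numeral_3_eq_3 numeral_2_eq_2 less_Suc_eq)
      qed blast
    qed
  qed
qed

end

section \<open>Alternating sign matrices\<close>

lemma is_asm_asm_array:
  assumes "is_asm A"
  shows "asm_array (dim_row A) (\<lambda>i j. A $$ (i, j))"
proof -
  have sq: "dim_col A = dim_row A" using is_asm_square[OF assms] by simp
  have row: "alternating_line (row A i)" and col: "alternating_line (col A i)"
    if "i < dim_row A" for i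
    using assms that sq by (simp_all add: is_asm_def)
  show ?thesis
  proof
    fix i k assume i: "i < dim_row A" and k: "k \<le> dim_row A"
    show "(\<Sum>j<k. A $$ (i, j)) \<in> {0, 1}"
      using alternating_line_prefix_sum[OF row[OF i], of k] i k sq by simp
    show "(\<Sum>j<k. A $$ (j, i)) \<in> {0, 1}"
      using alternating_line_prefix_sum[OF col[OF i], of k] i k sq by simp
  next
    fix i assume i: "i < dim_row A"
    show "(\<Sum>j<dim_row A. A $$ (i, j)) = 1"
      using alternating_line_sum[OF row[OF i]] i sq by simp
    show "(\<Sum>j<dim_row A. A $$ (j, i)) = 1"
      using alternating_line_sum[OF col[OF i]] i sq by simp
  qed
qed

lemma alternating_line_unit:
  assumes c: "c < dim_vec v" and v: "\<And>j. j < dim_vec v \<Longrightarrow> v $ j = (if j = c then 1 else 0)"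
  shows "alternating_line v"
proof -
  have "[0..<dim_vec v] = [0..<c] @ c # [Suc c..<dim_vec v]"
    using c by (metis le0 less_imp_le_nat upt_add_eq_append upt_conv_Cons le_Suc_ex)
  moreover have "list_of_vec v = map (\<lambda>j. if j = c then 1 else 0) [0..<dim_vec v]"
    by (rule nth_equalityI) (simp_all add: list_of_vec_index v)
  ultimately have "filter (\<lambda>x. x \<noteq> 0) (list_of_vec v) = [1]"
    by (simp add: filter_empty_conv)
  then show ?thesis by (simp add: alternating_line_def)
qed

lemma is_asm_permutation_matrix:
  assumes n: "0 < n" and P: "permutation_matrix n P"
  shows "is_asm P"
proof -
  obtain p where p: "p permutes {..<n}" and P: "P = mat n n (\<lambda>(i, j). if j = p i then 1 else 0)"
    using P unfolding permutation_matrix_def by blast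
  have "alternating_line (row P i)" if "i < n" for i
    using that permutes_in_image[OF p, of i] by (intro alternating_line_unit[of "p i"]) (simp_all add: P)
  moreover have "alternating_line (col P j)" if j: "j < n" for j
  proof (rule alternating_line_unit[of "inv_into UNIV p j"])
    show "inv_into UNIV p j < dim_vec (col P j)"
      using j permutes_in_image[OF permutes_inv[OF p], of j] by (simp add: P)
    show "col P j $ i = (if i = inv_into UNIV p j then 1 else 0)" if "i < dim_vec (col P j)" for i
      using j that permutes_inverses[OF p] by (auto simp: P)
  qed
  moreover have "elements_mat P \<subseteq> {0, 1, -1}" by (auto simp: elements_mat_def P)
  ultimately show ?thesis using n by (simp add: is_asm_def P)
qed

lemma permutation_matrix_of_unit_transversal:
  assumes A: "A \<in> carrier_mat n n" and p: "bij_betw p {..<n} {..<n}"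
  shows "\<exists>P. permutation_matrix n P \<and> frobenius_inner A P = (\<Sum>i<n. A $$ (i, p i))"
proof -
  define q where "q i = (if i < n then p i else i)" for i
  have "bij_betw q {..<n} {..<n}" using p by (subst bij_betw_cong[of _ q p]) (simp_all add: q_def)
  then have q: "q permutes {..<n}" by (rule bij_imp_permutes) (simp add: q_def)
  define P :: "int mat" where "P = mat n n (\<lambda>(i, j). if j = q i then 1 else 0)"
  have "(\<Sum>j<n. A $$ (i, j) * P $$ (i, j)) = A $$ (i, p i)" if i: "i < n" for i
  proof -
    have "(\<Sum>j<n. A $$ (i, j) * P $$ (i, j)) = (\<Sum>j<n. if j = p i then A $$ (i, j) else 0)"
      using i by (intro sum.cong) (auto simp: P_def q_def)
    also have "\<dots> = A $$ (i, p i)" using bij_betw_apply[OF p, of i] i by simp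
    finally show ?thesis .
  qed
  then have "frobenius_inner A P = (\<Sum>i<n. A $$ (i, p i))"
    using A by (simp add: frobenius_inner_def)
  moreover have "permutation_matrix n P" using q unfolding permutation_matrix_def P_def by blast
  ultimately show ?thesis by blast
qed

lemma I2_mat: "I2 = mat 2 2 (\<lambda>(i, j). if i = j then 1 else 0)"
  by (rule eq_matI) (auto simp: I2_def mat_of_rows_list_def less_2_cases_iff)

lemma I2'_mat: "I2' = mat 2 2 (\<lambda>(i, j). if i = j then 0 else 1)"
  by (rule eq_matI) (auto simp: I2'_def mat_of_rows_list_def less_2_cases_iff)

lemma D3_mat:
  "D3 = mat 3 3 (\<lambda>(i, j). if i = 1 \<and> j = 1 then -1 else if i = 1 \<or> j = 1 then 1 else 0)"
  by (rule eq_matI)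
    (auto simp: D3_def mat_of_rows_list_def numeral_3_eq_3 numeral_2_eq_2 less_Suc_eq)

text \<open>Line sums alone are inconsistent with inner product \<open>1\<close>. For order \<open>2\<close> the two entries picked by
the permutation are equal, so the inner product is even. For the diamond it equals \<open>2 - 3 b\<close>
with \<open>b\<close> the central entry.\<close>

lemma exceptional_has_no_mate:
  assumes "A \<in> {I2, I2', D3}"
  shows "\<not> has_orthogonal_mate A"
proof
  assume "has_orthogonal_mate A"
  then obtain B where B: "is_asm B" "dim_row A = dim_row B" "frobenius_inner A B = 1"
    by (auto simp: has_orthogonal_mate_def orthogonal_mate_def)
  interpret B: asm_array "dim_row B" "\<lambda>i j. B $$ (i, j)" by (rule is_asm_asm_array[OF B(1)])
  from assms consider "A = I2" | "A = I2'" | "A = D3" by blast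
  then show False
  proof cases
    case 1
    with B(2) have "dim_row B = 2" by (simp add: I2_def mat_of_rows_list_def)
    with B(3) 1 B.row_sum[of 0] B.col_sum[of 1] have
      "B $$ (0, 0) + B $$ (1, 1) = 1" "B $$ (0, 0) + B $$ (0, 1) = 1" "B $$ (0, 1) + B $$ (1, 1) = 1"
      by (simp_all add: frobenius_inner_def I2_def mat_of_rows_list_def numeral_2_eq_2)
    then show False by presburger
  next
    case 2
    with B(2) have "dim_row B = 2" by (simp add: I2'_def mat_of_rows_list_def)
    with B(3) 2 B.row_sum[of 0] B.col_sum[of 0] have
      "B $$ (0, 1) + B $$ (1, 0) = 1" "B $$ (0, 0) + B $$ (0, 1) = 1" "B $$ (0, 0) + B $$ (1, 0) = 1"
      by (simp_all add: frobenius_inner_def I2'_def mat_of_rows_list_def numeral_2_eq_2)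
    then show False by presburger
  next
    case 3
    with B(2) have "dim_row B = 3" by (simp add: D3_def mat_of_rows_list_def)
    with B(3) 3 B.row_sum[of 1] B.col_sum[of 1] have
      "B $$ (0, 1) + (B $$ (1, 0) - B $$ (1, 1) + B $$ (1, 2)) + B $$ (2, 1) = 1"
      "B $$ (1, 0) + B $$ (1, 1) + B $$ (1, 2) = 1" "B $$ (0, 1) + B $$ (1, 1) + B $$ (2, 1) = 1"
      by (simp_all add: frobenius_inner_def D3_def mat_of_rows_list_def numeral_3_eq_3 numeral_2_eq_2)
    then show False by presburger
  qed
qed

theorem theorem3p1:
  fixes A :: "int mat"
  assumes "is_asm A"
  shows "(has_orthogonal_mate A \<longleftrightarrow> A \<notin> {I2, I2', D3}) \<and>
    (has_orthogonal_mate A \<longrightarrow>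
      (\<exists>P. permutation_matrix (dim_row A) P \<and> frobenius_inner A P = 1))"
proof -
  let ?n = "dim_row A"
  interpret A: asm_array ?n "\<lambda>i j. A $$ (i, j)" by (rule is_asm_asm_array[OF assms])
  have sq: "dim_col A = ?n" using is_asm_square[OF assms] by simp
  have pos: "0 < ?n" using assms by (simp add: is_asm_def)
  have perm: "\<exists>P. permutation_matrix ?n P \<and> frobenius_inner A P = 1" if "A \<notin> {I2, I2', D3}"
  proof -
    have "A = I2" if "?n = 2" "\<forall>i<2. \<forall>j<2. A $$ (i, j) = (if i = j then 1 else 0)"
      unfolding I2_mat using that sq by (intro eq_matI) simp_all
    moreover have "A = I2'" if "?n = 2" "\<forall>i<2. \<forall>j<2. A $$ (i, j) = (if i = j then 0 else 1)"
      unfolding I2'_mat using that sq by (intro eq_matI) simp_all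
    moreover have "A = D3" if "?n = 3" "\<forall>i<3. \<forall>j<3. A $$ (i, j) =
        (if i = 1 \<and> j = 1 then -1 else if i = 1 \<or> j = 1 then 1 else 0)"
      unfolding D3_mat using that sq by (intro eq_matI) simp_all
    ultimately have "A.unit_transversal"
      using that A.unit_transversal_or_exceptional[OF pos] by blast
    then show ?thesis
      using permutation_matrix_of_unit_transversal[of A ?n] sq unfolding A.unit_transversal_def
      by (metis carrier_matI)
  qed
  have "has_orthogonal_mate A" if notin: "A \<notin> {I2, I2', D3}"
  proof -
    obtain P where P: "permutation_matrix ?n P" "frobenius_inner A P = 1" using perm[OF notin] by blast
    then have "dim_row P = ?n" "dim_col P = ?n" by (auto simp: permutation_matrix_def)
    then show ?thesis
      using P assms sq is_asm_permutation_matrix[OF pos P(1)]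
      by (auto simp: has_orthogonal_mate_def orthogonal_mate_def)
  qed
  then show ?thesis using perm exceptional_has_no_mate by blast
qed

end
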